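(* Let $Q=T[H_1,\dots,H_t]$ be a strong semicomplete composition of order $n$. For every $k\in\{1,\dots,n\}$ and $i\in\{1,\dots,t\}$, there exists an integer $n_{i,k}$ such that every maximum $k$-path subdigraph $\mathcal{F}$ of $Q$ satisfies $|V(H_i)\cap V(\mathcal{F})|=n_{i,k}$ and no $k$-path subdigraph of $Q$ contains more than $n_{i,k}$ vertices of $H_i$.
   Context: Digraphs are finite, without loops or parallel arcs (2-cycles are allowed); paths are directed, and a single vertex is a path. A digraph is semicomplete if there is at least one arc between every pair of distinct vertices. Let $T$ be a digraph with vertices $u_1,\dots,u_t$ ($t\ge 2$) and let $H_1,\dots,H_t$ be pairwise disjoint nonempty digraphs. The composition $Q=T[H_1,\dots,H_t]$ is the digraph with vertex set $\bigcup_i V(H_i)$ and arc set $\bigcup_{i=1}^t A(H_i)\cup\{xy : x\in V(H_i),\ y\in V(H_p),\ u_iu_p\in A(T)\}$. It is a semicomplete composition if $T$ is semicomplete. A digraph is strong if for every ordered pair of vertices $(x,y)$ there is a directed path from $x$ to $y$. A $k$-path subdigraph of a digraph $D$ is a collection of $k$ pairwise vertex-disjoint paths of $D$; $V(\mathcal{F})$ is the set of vertices covered by the paths in $\mathcal{F}$. A maximum $k$-path subdigraph is a $k$-path subdigraph covering the maximum number of vertices among all $k$-path subdigraphs of $D$. *)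

theory Defs
  imports "Graph_Theory.Graph_Theory"
begin

text \<open>
  Digraphs without parallel arcs are pair digraphs; the locale \<open>pair_digraph\<close> adds
  finiteness and the absence of loops.  The vertices \<open>u\<^sub>1, \<dots>, u\<^sub>t\<close> of \<open>T\<close> themselves serve as
  the index set of the family \<open>H\<close>.
\<close>

definition semicomplete :: "'a pair_pre_digraph \<Rightarrow> bool" where
  "semicomplete D \<longleftrightarrow>
     (\<forall>u\<in>pverts D. \<forall>v\<in>pverts D. u \<noteq> v \<longrightarrow> (u, v) \<in> parcs D \<or> (v, u) \<in> parcs D)"

definition composition ::
  "'i pair_pre_digraph \<Rightarrow> ('i \<Rightarrow> 'a pair_pre_digraph) \<Rightarrow> 'a pair_pre_digraph" where
  "composition T H =
     \<lparr> pverts = (\<Union>i\<in>pverts T. pverts (H i)),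
       parcs = (\<Union>i\<in>pverts T. parcs (H i)) \<union>
         {(x, y) | x y i p. x \<in> pverts (H i) \<and> y \<in> pverts (H p) \<and> (i, p) \<in> parcs T} \<rparr>"

text \<open>A path is represented by its nonempty, repetition-free list of vertices.\<close>

definition k_path_subdigraph :: "'a pair_pre_digraph \<Rightarrow> nat \<Rightarrow> 'a list set \<Rightarrow> bool" where
  "k_path_subdigraph D k F \<longleftrightarrow>
     finite F \<and> card F = k \<and> (\<forall>p\<in>F. vpath p (with_proj D)) \<and>
     pairwise (\<lambda>p q. disjnt (set p) (set q)) F"

definition covered_verts :: "'a list set \<Rightarrow> 'a set" where
  "covered_verts F = (\<Union>p\<in>F. set p)"

definition maximum_k_path_subdigraph :: "'a pair_pre_digraph \<Rightarrow> nat \<Rightarrow> 'a list set \<Rightarrow> bool" where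
  "maximum_k_path_subdigraph D k F \<longleftrightarrow>
     k_path_subdigraph D k F \<and>
     (\<forall>F'. k_path_subdigraph D k F' \<longrightarrow> card (covered_verts F') \<le> card (covered_verts F))"

end

theory Submission
  imports Defs "HOL-Combinatorics.Cycles"
begin

text \<open>
  Forget the arcs inside the \<open>H\<^sub>i\<close> and contract each maximal subpath of a path inside some \<open>H\<^sub>i\<close> to
  one of its vertices. Closing each of the \<open>k\<close> paths through an additional vertex adjacent to and
  from everything turns a \<open>k\<close>-path subdigraph into a permutation of the vertices of an extended
  semicomplete digraph whose moved points follow arcs.

  Let such a permutation \<open>p\<close> have an inclusion-maximal set of moved points and let \<open>v\<close> be a fixed
  point in the class \<open>L\<close>. Let \<open>A\<close> be the set of vertices reachable from \<open>v\<close> along the steps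
  \<open>u \<mapsto> a\<close> with \<open>u \<rightarrow> p a\<close> an arc. By maximality no vertex of \<open>A\<close> dominates \<open>v\<close>, hence by
  semicompleteness \<open>v\<close> dominates all of \<open>A - L\<close>. Counting the arcs leaving \<open>A \<union> L\<close> then shows that
  no permutation moves more points of \<open>L\<close> than \<open>p\<close> does. So \<open>p\<close> is optimal for all classes at once.

  A cycle avoiding the additional vertices can be merged into one through them, so \<open>p\<close> may be taken
  to come from \<open>k\<close> paths. Replacing the vertices of class \<open>i\<close> on them by the paths of a best possible
  path subdigraph of \<open>H\<^sub>i\<close> with as many paths as \<open>p\<close> moves vertices of that class gives a
  \<open>k\<close>-path subdigraph of \<open>Q\<close> that is optimal in every \<open>H\<^sub>i\<close> simultaneously.
\<close>

section \<open>Simple paths, cyclic lists and powers of permutations\<close>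

lemma rtrancl_distinct_list:
  assumes "(v, u) \<in> R\<^sup>*"
  obtains xs where "xs \<noteq> []" "distinct xs" "hd xs = v" "last xs = u"
    "successively (\<lambda>x y. (x, y) \<in> R) xs"
proof -
  have "\<exists>xs. xs \<noteq> [] \<and> distinct xs \<and> hd xs = v \<and> last xs = u \<and> successively (\<lambda>x y. (x, y) \<in> R) xs"
    using assms
  proof (induction rule: rtrancl_induct)
    case base
    show ?case by (intro exI[of _ "[v]"]) auto
  next
    case (step y z)
    then obtain xs where xs: "xs \<noteq> []" "distinct xs" "hd xs = v" "last xs = y"
      "successively (\<lambda>x y. (x, y) \<in> R) xs" by blast
    show ?case
    proof (cases "z \<in> set xs")
      case True
      \<comment> \<open>The new endpoint lies on the list already; cutting the list there keeps it
        distinct.\<close>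
      then obtain ys zs where "xs = ys @ z # zs" by (auto dest: split_list)
      then show ?thesis using xs
        by (intro exI[of _ "ys @ [z]"]) (auto simp: successively_append_iff hd_append)
    next
      case False
      then show ?thesis using xs step
        by (intro exI[of _ "xs @ [z]"]) (auto simp: successively_append_iff)
    qed
  qed
  then show thesis using that by blast
qed

lemma cycle_of_list_nth:
  assumes "distinct xs" "i < length xs"
  shows "cycle_of_list xs (xs ! i) = xs ! (Suc i mod length xs)"
proof -
  have "map (cycle_of_list xs) xs = rotate1 xs"
    using cyclic_rotation[OF assms(1), of 1] by simp
  then show ?thesis using assms(2) by (metis nth_map nth_rotate1)
qed

lemma cycle_of_list_successively:
  assumes "distinct xs" "successively P xs" "P (last xs) (hd xs)" "x \<in> set xs"
  shows "P x (cycle_of_list xs x)"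
proof -
  obtain i where i: "i < length xs" "x = xs ! i" using assms(4) by (auto simp: in_set_conv_nth)
  show ?thesis
  proof (cases "Suc i < length xs")
    case True
    then show ?thesis using assms(2) i cycle_of_list_nth[OF assms(1) i(1)]
      by (simp add: successively_conv_nth)
  next
    case False
    then have "Suc i = length xs" using i by simp
    then show ?thesis using assms i cycle_of_list_nth[OF assms(1) i(1)]
      by (metis hd_conv_nth last_conv_nth list.size(3) mod_self nat.distinct(1) diff_Suc_1)
  qed
qed

text \<open>Going forward often enough undoes one step of \<open>p\<close>, so facts that travel
  along \<open>p\<close> in one direction reach the whole cycle.\<close>

lemma permutes_funpow_cycle:
  assumes "p permutes S" "finite S"
  obtains n where "(p ^^ n) (p u) = u"
proof -
  have "permutation p" using assms by (auto simp: permutation_permutes)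
  then obtain n where "p ^^ n = id" "n > 0" using permutation_is_nilpotent by blast
  then have "(p ^^ Suc (n - 1)) u = u" by simp
  then show thesis using that[of "n - 1"] by (simp add: funpow_swap1)
qed

section \<open>Cycle covers of extended semicomplete digraphs\<close>

abbreviation moved :: "('v \<Rightarrow> 'v) \<Rightarrow> 'v set" where
  "moved p \<equiv> {u. p u \<noteq> u}"

text \<open>The relation \<open>r\<close> lives on classes, so vertices of one class are
  non-adjacent and have the same in- and out-neighbours. The counting below rests on this
  exchangeability.\<close>

locale extended_semicomplete =
  fixes V :: "'v set" and cls :: "'v \<Rightarrow> 'c" and r :: "'c \<Rightarrow> 'c \<Rightarrow> bool"
  assumes finite_V: "finite V"
    and irrefl: "\<not> r i i"
    and semicomp: "u \<in> V \<Longrightarrow> w \<in> V \<Longrightarrow> cls u \<noteq> cls w \<Longrightarrow> r (cls u) (cls w) \<or> r (cls w) (cls u)"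
begin

definition arc :: "'v \<Rightarrow> 'v \<Rightarrow> bool" where
  "arc u w \<longleftrightarrow> r (cls u) (cls w)"

text \<open>A family of disjoint cycles is encoded as one permutation whose fixed points are the
  uncovered vertices; rerouting the cycles then means composing with another permutation.\<close>

definition cycle_cover :: "('v \<Rightarrow> 'v) \<Rightarrow> bool" where
  "cycle_cover p \<longleftrightarrow> p permutes V \<and> (\<forall>u. p u \<noteq> u \<longrightarrow> arc u (p u))"

definition maximal_cover :: "('v \<Rightarrow> 'v) \<Rightarrow> bool" where
  "maximal_cover p \<longleftrightarrow> cycle_cover p \<and> (\<forall>q. cycle_cover q \<longrightarrow> \<not> moved p \<subset> moved q)"

lemma arc_neq: "arc u w \<Longrightarrow> u \<noteq> w"
  using irrefl by (auto simp: arc_def)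

lemma moved_subset: "cycle_cover p \<Longrightarrow> moved p \<subseteq> V"
  by (auto simp: cycle_cover_def permutes_def)

lemma maximal_cover_exists: "\<exists>p. maximal_cover p"
proof -
  let ?M = "{moved p | p. cycle_cover p}"
  have "finite ?M" by (rule finite_subset[of _ "Pow V"]) (use moved_subset finite_V in auto)
  moreover have "cycle_cover id" by (simp add: cycle_cover_def permutes_id)
  then have "?M \<noteq> {}" by blast
  ultimately obtain m where "m \<in> ?M" "\<forall>b\<in>?M. m \<subseteq> b \<longrightarrow> m = b"
    using finite_has_maximal[of ?M] by blast
  then show ?thesis unfolding maximal_cover_def by blast
qed

text \<open>This is an augmenting path for the bipartite matching that joins each \<open>u\<close>
  to \<open>p u\<close>. After composing with the cycle along the list, every vertex of the list
  takes over the old successor \<open>p a\<close> of the next vertex \<open>a\<close>, and the last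
  one is sent to \<open>p v = v\<close>.\<close>

lemma augment_cycle_cover:
  assumes p: "cycle_cover p" and v: "v \<in> V" "p v = v"
    and path: "(v, u) \<in> {(x, a). a \<in> V \<and> arc x (p a)}\<^sup>*" and closing: "arc u v"
  shows "\<exists>q. cycle_cover q \<and> insert v (moved p) \<subseteq> moved q"
proof -
  obtain xs where xs: "xs \<noteq> []" "distinct xs" "hd xs = v" "last xs = u"
    "successively (\<lambda>x y. (x, y) \<in> {(x, a). a \<in> V \<and> arc x (p a)}) xs"
    by (rule rtrancl_distinct_list[OF path])
  define c where "c = cycle_of_list xs"
  have succ: "successively (\<lambda>x y. y \<in> V \<and> arc x (p y)) xs"
    using xs(5) by simp
  have *: "c x \<in> V \<and> arc x (p (c x))" if "x \<in> set xs" for x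
    unfolding c_def
    by (rule cycle_of_list_successively[OF xs(2) succ _ that]) (use xs v closing in simp)
  have out: "c x = x" if "x \<notin> set xs" for x
    using that by (simp add: c_def id_outside_supp)
  have "c ` set xs = set xs"
    unfolding c_def using cycle_is_surj[OF xs(2)] .
  moreover have "c ` set xs \<subseteq> V" using * by auto
  ultimately have "set xs \<subseteq> V" by simp
  then have "c permutes V"
    unfolding c_def using cycle_permutes permutes_subset by blast
  then have "(p \<circ> c) permutes V"
    using p permutes_compose by (auto simp: cycle_cover_def)
  moreover have arc_pc: "arc x ((p \<circ> c) x)" if "x \<in> set xs \<or> x \<in> moved p" for x
    using that * out[of x] p by (cases "x \<in> set xs") (auto simp: cycle_cover_def)
  moreover have "(p \<circ> c) x = x" if "\<not> (x \<in> set xs \<or> x \<in> moved p)" for x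
    using that out[of x] by simp
  moreover have "v \<in> set xs" using xs by auto
  ultimately have "cycle_cover (p \<circ> c)"
    unfolding cycle_cover_def by blast
  moreover have "insert v (moved p) \<subseteq> moved (p \<circ> c)"
  proof
    fix x assume "x \<in> insert v (moved p)"
    then have "x \<in> set xs \<or> x \<in> moved p" using \<open>v \<in> set xs\<close> by blast
    then show "x \<in> moved (p \<circ> c)" using arc_pc[of x] arc_neq[of x "(p \<circ> c) x"] by auto
  qed
  ultimately show ?thesis by blast
qed

text \<open>If \<open>p\<close> moves the whole class, there is nothing to show. Otherwise the
  out-neighbourhood \<open>B\<close> of the set reachable from a fixed point \<open>v\<close> of the
  class is a bottleneck: a family of cycles gets at most \<open>card (B - A0)\<close> vertices of
  the class through it, and \<open>p\<close> moves at least that many.\<close>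

lemma maximal_cover_class:
  assumes p: "maximal_cover p"
    and q: "S \<subseteq> V" "inj_on q S" "q ` S \<subseteq> S" "\<And>u. u \<in> S \<Longrightarrow> arc u (q u)"
  shows "card {u \<in> S. cls u = i} \<le> card {u \<in> moved p. cls u = i}"
proof (cases "\<exists>v\<in>V. cls v = i \<and> p v = v")
  case False
  then have "{u \<in> S. cls u = i} \<subseteq> {u \<in> moved p. cls u = i}" using q(1) by auto
  moreover have "finite {u \<in> moved p. cls u = i}"
    using p moved_subset finite_V by (auto simp: maximal_cover_def intro: finite_subset)
  ultimately show ?thesis by (rule card_mono[rotated])
next
  case True
  then obtain v where v: "v \<in> V" "cls v = i" "p v = v" by blast
  have pp: "p permutes V" and cov: "cycle_cover p"
    using p by (auto simp: maximal_cover_def cycle_cover_def)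
  define A where "A = {u. (v, u) \<in> {(x, a). a \<in> V \<and> arc x (p a)}\<^sup>*}"
  have vA: "v \<in> A" by (simp add: A_def)
  have A_step: "a \<in> A" if "u \<in> A" "a \<in> V" "arc u (p a)" for u a
    using that by (auto simp: A_def intro: rtrancl_into_rtrancl)
  have AV: "u \<in> V" if "u \<in> A" for u
    using that v(1) unfolding A_def mem_Collect_eq by (induction rule: rtrancl_induct) auto
  have no_arc: "\<not> arc u v" if uA: "u \<in> A" for u
  proof
    assume "arc u v"
    then obtain q where "cycle_cover q" "insert v (moved p) \<subseteq> moved q"
      using augment_cycle_cover[OF cov v(1,3)] uA unfolding A_def by blast
    then show False using p v(3) by (auto simp: maximal_cover_def)
  qed
  define L where "L = {u \<in> V. cls u = i}"
  define B where "B = {b \<in> V. \<exists>u\<in>A. arc u b}"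
  define A0 where "A0 = A - L"
  have fin: "finite L" "finite B" "finite A0" "finite A" "finite S"
    using finite_V AV q(1) by (auto simp: L_def B_def A0_def intro: finite_subset)
  \<comment> \<open>Arcs depend on classes only, so an arc from \<open>A\<close> into
    \<open>L\<close> would give an arc into \<open>v\<close> and close an augmenting path.\<close>
  have BL: "B \<inter> L = {}"
    using no_arc v by (auto simp: B_def L_def arc_def)
  have A0B: "A0 \<subseteq> B"
  proof
    fix u assume u: "u \<in> A0"
    then have "u \<in> V" "cls u \<noteq> cls v" "\<not> arc u v"
      using AV no_arc v(2) by (auto simp: A0_def L_def)
    then have "arc v u" using semicomp[of u v] v(1) by (auto simp: arc_def)
    then show "u \<in> B" using vA \<open>u \<in> V\<close> by (auto simp: B_def)
  qed
  \<comment> \<open>A vertex of \<open>L\<close> has the same out-neighbours as \<open>v\<close>, so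
    its successor lies in \<open>B\<close> even if the vertex is not in \<open>A\<close>.\<close>
  have "q ` ((L \<union> A0) \<inter> S) \<subseteq> B \<inter> S"
  proof
    fix b assume "b \<in> q ` ((L \<union> A0) \<inter> S)"
    then obtain u where u: "u \<in> S" "b = q u" "u \<in> L \<or> u \<in> A" by (auto simp: A0_def)
    then have "arc u b" "b \<in> S" using q by auto
    moreover have "arc v b" if "u \<in> L" using that \<open>arc u b\<close> v(2) by (auto simp: arc_def L_def)
    ultimately show "b \<in> B \<inter> S" using u vA q(1) by (auto simp: B_def)
  qed
  then have "card ((L \<union> A0) \<inter> S) \<le> card (B \<inter> S)"
    using q(2) fin by (intro card_inj_on_le[of q]) (auto intro: inj_on_subset)
  moreover have "card ((L \<union> A0) \<inter> S) = card (L \<inter> S) + card (A0 \<inter> S)"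
    unfolding Int_Un_distrib2 by (rule card_Un_disjoint) (use fin in \<open>auto simp: A0_def\<close>)
  moreover have "card (B \<inter> S) \<le> card (A0 \<inter> S) + card (B - A0)"
    by (rule order_trans[OF card_mono card_Un_le]) (use fin in auto)
  ultimately have 1: "card (L \<inter> S) \<le> card (B - A0)" by linarith
  \<comment> \<open>The preimage under \<open>p\<close> of a vertex of \<open>B\<close> is reachable
    by one more step, hence in \<open>A\<close>. It is moved: a fixed point in both \<open>A\<close>
    and \<open>B\<close> lies outside \<open>L\<close>, hence in \<open>A0\<close>, and the
    left-hand side contains no fixed point of \<open>A0\<close>.\<close>
  have "A0 \<inter> moved p \<union> (B - A0) \<subseteq> p ` (A \<inter> moved p)"
  proof
    fix b assume b: "b \<in> A0 \<inter> moved p \<union> (B - A0)"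
    then have bB: "b \<in> B" using A0B by blast
    then obtain u where "u \<in> A" "arc u b" "b \<in> V" by (auto simp: B_def)
    moreover obtain a where a: "a \<in> V" "b = p a"
      using pp \<open>b \<in> V\<close> by (metis permutes_image imageE)
    ultimately have "a \<in> A" using A_step by blast
    moreover have "p a \<noteq> a"
      using b bB a \<open>a \<in> A\<close> BL by (auto simp: A0_def)
    ultimately show "b \<in> p ` (A \<inter> moved p)" using a by blast
  qed
  then have "card (A0 \<inter> moved p \<union> (B - A0)) \<le> card (A \<inter> moved p)"
    using fin by (meson card_image_le card_mono finite_Int finite_imageI order_trans)
  moreover have "card (A0 \<inter> moved p \<union> (B - A0)) = card (A0 \<inter> moved p) + card (B - A0)"
    by (rule card_Un_disjoint) (use fin in auto)
  moreover have "card (A \<inter> moved p) \<le> card (L \<inter> moved p) + card (A0 \<inter> moved p)"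
    by (rule order_trans[OF card_mono card_Un_le]) (use fin in \<open>auto simp: A0_def\<close>)
  ultimately have "card (L \<inter> S) \<le> card (L \<inter> moved p)" using 1 by linarith
  moreover have "L \<inter> S = {u \<in> S. cls u = i}" using q(1) by (auto simp: L_def)
  moreover have "L \<inter> moved p = {u \<in> moved p. cls u = i}"
    using moved_subset[OF cov] by (auto simp: L_def)
  ultimately show ?thesis by simp
qed

section \<open>Merging all cycles with those through one class\<close>

text \<open>The definition looks forward only. As a permutation of the finite vertex set returns, it
  is nevertheless an invariant of the whole cycle of \<open>u\<close>, which
  \<open>hits_step_iff\<close> records.\<close>

inductive hits :: "'c \<Rightarrow> ('v \<Rightarrow> 'v) \<Rightarrow> 'v \<Rightarrow> bool" for s p where
  here: "cls u = s \<Longrightarrow> hits s p u"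
| step: "hits s p (p u) \<Longrightarrow> hits s p u"

lemma hits_funpow: "hits s p ((p ^^ n) u) \<Longrightarrow> hits s p u"
  by (induction n) (auto intro: hits.step)

lemma hits_step_iff:
  assumes "p permutes V"
  shows "hits s p (p u) \<longleftrightarrow> hits s p u"
proof
  assume "hits s p u"
  obtain n where "(p ^^ n) (p u) = u"
    using permutes_funpow_cycle[OF assms finite_V, of u] by metis
  then show "hits s p (p u)" using \<open>hits s p u\<close> hits_funpow by metis
qed (rule hits.step)

text \<open>If no pair exists, the property of dominating a point of a cycle avoiding class \<open>s\<close> propagates
  along the cycle of \<open>t\<close> and never meets class \<open>s\<close> again, so the cycle cannot return to \<open>t\<close>.\<close>

lemma merge_pair_exists:
  assumes p: "cycle_cover p" and t: "t \<in> V" "cls t = s"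
    and univ: "\<And>u. u \<in> V \<Longrightarrow> cls u \<noteq> s \<Longrightarrow> r s (cls u) \<and> r (cls u) s"
    and c0: "c0 \<in> moved p" "\<not> hits s p c0"
  obtains c d where "c \<in> moved p" "\<not> hits s p c" "hits s p d" "d \<in> V" "arc d (p c)" "arc c (p d)"
proof (rule ccontr)
  note pair = that
  assume no: "\<not> thesis"
  have pp: "p permutes V" and parc: "\<And>u. p u \<noteq> u \<Longrightarrow> arc u (p u)"
    using p by (auto simp: cycle_cover_def)
  have inV: "p u \<in> V \<longleftrightarrow> u \<in> V" for u using pp by (rule permutes_in_image)
  define C where "C = {c \<in> moved p. \<not> hits s p c}"
  have CV: "C \<subseteq> V" using moved_subset[OF p] by (auto simp: C_def)
  have noD: False if "c \<in> C" "hits s p d" "d \<in> V" "arc d (p c)" "arc c (p d)" for c d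
    using that no pair by (auto simp: C_def)
  \<comment> \<open>A good vertex is one half of the pair sought: \<open>u\<close> can take over the
    successor of some \<open>c\<close>. Only the arc from \<open>c\<close> to \<open>p u\<close> can
    be missing.\<close>
  define good where "good u \<longleftrightarrow> u \<in> V \<and> hits s p u \<and> (\<exists>c\<in>C. arc u (p c))" for u
  have c0C: "c0 \<in> C" using c0 by (simp add: C_def)
  have C_inv: "\<exists>c'\<in>C. p c' = c" if "c \<in> C" for c
  proof -
    obtain c' where c': "p c' = c" using pp by (metis permutes_surj surjD)
    have "c' \<in> C"
      using that hits_step_iff[OF pp, of s c'] unfolding C_def c'[symmetric] by auto
    then show ?thesis using c' by blast
  qed
  have not_s: "cls c \<noteq> s" if "\<not> hits s p c" for c
    using that hits.here by blast
  have good_t: "good t"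
  proof -
    have "\<not> hits s p (p c0)" using c0 hits.step by blast
    then have "arc t (p c0)"
      using univ[of "p c0"] not_s t inV CV c0C by (auto simp: arc_def)
    then show ?thesis using t c0C hits.here by (auto simp: good_def)
  qed
  \<comment> \<open>Without a pair, \<open>c\<close> does not dominate \<open>p u\<close>. As
    \<open>c\<close> dominates all of class \<open>s\<close>, \<open>p u\<close> lies outside it.
    Either \<open>p u\<close> shares the class of \<open>c\<close> and inherits the arc to
    \<open>p c\<close>, or semicompleteness gives an arc from \<open>p u\<close> to
    \<open>c\<close>, which is the successor of a point of \<open>C\<close>.\<close>
  have good_step: "good (p u) \<and> cls (p u) \<noteq> s" if u: "good u" for u
  proof -
    obtain c where c: "c \<in> C" "arc u (p c)" using u by (auto simp: good_def)
    have uV: "u \<in> V" "hits s p u" using u by (auto simp: good_def)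
    have na: "\<not> arc c (p u)" using noD c uV by blast
    have cV: "c \<in> V" "cls c \<noteq> s" using c CV not_s by (auto simp: C_def)
    then have ns: "cls (p u) \<noteq> s"
      using na univ[of c] by (auto simp: arc_def)
    have "\<exists>c'\<in>C. arc (p u) (p c')"
    proof (cases "cls c = cls (p u)")
      case True
      then show ?thesis using parc[of c] c by (auto simp: C_def arc_def)
    next
      case False
      then have "arc (p u) c"
        using na semicomp[of c "p u"] cV uV inV by (auto simp: arc_def)
      then show ?thesis using C_inv[OF c(1)] by auto
    qed
    then show ?thesis
      using ns uV inV hits_step_iff[OF pp] by (auto simp: good_def)
  qed
  have "good ((p ^^ n) t)" for n
    by (induction n) (use good_t good_step in auto)
  moreover obtain n where "p ((p ^^ n) t) = t"
    using permutes_funpow_cycle[OF pp finite_V, of t] by (metis funpow_swap1)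
  ultimately show False using good_step[of "(p ^^ n) t"] t(2) by auto
qed

text \<open>Exchanging the successors of \<open>c\<close> and \<open>d\<close> joins their cycles.
  If \<open>d\<close> is a fixed point of class \<open>s\<close>, the exchange inserts it into the
  cycle of \<open>c\<close>, so the set of moved points may grow.\<close>

lemma merge_step:
  assumes p: "cycle_cover p" and t: "t \<in> V" "cls t = s"
    and univ: "\<And>u. u \<in> V \<Longrightarrow> cls u \<noteq> s \<Longrightarrow> r s (cls u) \<and> r (cls u) s"
    and c0: "c0 \<in> moved p" "\<not> hits s p c0"
  obtains q where "cycle_cover q" "moved p \<subseteq> moved q"
    "{u \<in> V. \<not> hits s q u} \<subset> {u \<in> V. \<not> hits s p u}"
proof -
  obtain c d where cd: "c \<in> moved p" "\<not> hits s p c" "hits s p d" "d \<in> V" "arc d (p c)" "arc c (p d)"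
    by (rule merge_pair_exists[OF p t univ c0])
  have pp: "p permutes V" and parc: "\<And>u. p u \<noteq> u \<Longrightarrow> arc u (p u)"
    using p by (auto simp: cycle_cover_def)
  have cV: "c \<in> V" using cd(1) moved_subset[OF p] by blast
  define q where "q = p \<circ> transpose c d"
  have q: "q c = p d" "q d = p c" "\<And>u. u \<noteq> c \<Longrightarrow> u \<noteq> d \<Longrightarrow> q u = p u"
    by (auto simp: q_def)
  have "q permutes V"
    unfolding q_def by (intro permutes_compose permutes_swap_id pp cV cd)
  moreover have arc_q: "arc u (q u)" if "u = c \<or> u = d \<or> u \<in> moved p" for u
  proof (cases "u = c \<or> u = d")
    case True
    then show ?thesis using q(1,2) cd(5,6) by auto
  next
    case False
    then show ?thesis using that q(3)[of u] parc[of u] by auto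
  qed
  moreover have "q u = u" if "\<not> (u = c \<or> u = d \<or> u \<in> moved p)" for u
    using that q by auto
  ultimately have cov: "cycle_cover q"
    unfolding cycle_cover_def by blast
  have sub: "moved p \<subseteq> moved q"
  proof
    fix u assume "u \<in> moved p"
    then show "u \<in> moved q" using arc_q[of u] arc_neq[of u "q u"] by auto
  qed
  \<comment> \<open>On orbits that meet class \<open>s\<close>, \<open>q\<close> differs from
    \<open>p\<close> only at \<open>d\<close>; the second alternative accounts for this. Starting
    from \<open>p d\<close>, both alternatives coincide.\<close>
  have "hits s q u \<or> hits s q (p d)" if "hits s p u" for u
    using that
  proof induction
    case (step u)
    then have "u \<noteq> c" using cd(2) hits.step[of s p u] by blast
    then show ?case
      using step.IH q(3)[of u] hits.step[of s q u] by (cases "u = d") auto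
  qed (auto intro: hits.here)
  then have "hits s q (p d)" using cd(3) hits_step_iff[OF pp] by blast
  then have hc: "hits s q c" using q(1) hits.step[of s q c] by simp
  \<comment> \<open>On the old cycle of \<open>c\<close>, \<open>q\<close> follows \<open>p\<close>
    until it arrives at \<open>c\<close>, from where class \<open>s\<close> is now reached.\<close>
  have "hits s q u" if "(p ^^ n) u = c" "\<not> hits s p u" for n u
    using that
  proof (induction n arbitrary: u)
    case (Suc n)
    then have "hits s q (p u)"
      using Suc.IH[of "p u"] hits.step[of s p u] by (auto simp: funpow_swap1)
    moreover have "u \<noteq> d" using cd(3) Suc.prems(2) by blast
    ultimately show ?case using q(3)[of u] hc hits.step[of s q u] by (cases "u = c") auto
  qed (use hc in simp)
  moreover obtain n where "(p ^^ n) (p c) = c"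
    using permutes_funpow_cycle[OF pp finite_V, of c] by metis
  ultimately have "hits s q (p c)" using cd(2) hits.step[of s p c] by blast
  then have hd: "hits s q d" using q(2) hits.step[of s q d] by simp
  have "hits s q u" if "hits s p u" for u
    using that
  proof induction
    case (step u)
    then show ?case
      using q(3)[of u] hc hd hits.step[of s q u] by (cases "u = c \<or> u = d") auto
  qed (auto intro: hits.here)
  then have "{u \<in> V. \<not> hits s q u} \<subset> {u \<in> V. \<not> hits s p u}"
    using hc cd(2) cV by blast
  then show thesis using that cov sub by blast
qed

lemma merged_cover_exists:
  assumes "cycle_cover p" and t: "t \<in> V" "cls t = s"
    and univ: "\<And>u. u \<in> V \<Longrightarrow> cls u \<noteq> s \<Longrightarrow> r s (cls u) \<and> r (cls u) s"
  shows "\<exists>q. cycle_cover q \<and> moved p \<subseteq> moved q \<and> (\<forall>u\<in>moved q. hits s q u)"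
  using assms(1)
proof (induction "card {u \<in> V. \<not> hits s p u}" arbitrary: p rule: less_induct)
  case less
  show ?case
  proof (cases "\<forall>u\<in>moved p. hits s p u")
    case False
    then obtain c where c: "c \<in> moved p" "\<not> hits s p c" by blast
    obtain q where q: "cycle_cover q" "moved p \<subseteq> moved q"
      "{u \<in> V. \<not> hits s q u} \<subset> {u \<in> V. \<not> hits s p u}"
      by (rule merge_step[OF less.prems t univ c])
    then have "card {u \<in> V. \<not> hits s q u} < card {u \<in> V. \<not> hits s p u}"
      using finite_V by (intro psubset_card_mono) auto
    then show ?thesis using less.hyps[OF _ q(1)] q(2) by blast
  qed (use less.prems in blast)
qed

lemma hits_funpow_exists: "hits s p u \<Longrightarrow> \<exists>n. cls ((p ^^ n) u) = s"
proof (induction rule: hits.induct)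
  case (here u)
  then show ?case by (intro exI[of _ 0]) simp
next
  case (step u)
  then obtain n where "cls ((p ^^ n) (p u)) = s" by blast
  then show ?case by (intro exI[of _ "Suc n"]) (simp add: funpow_swap1)
qed

section \<open>Cutting a cycle cover into paths\<close>

text \<open>The cycles of \<open>q\<close> are cut at their vertices of class \<open>s\<close>;
  \<open>P t\<close> is the stretch that follows \<open>t\<close> up to the next such vertex,
  possibly \<open>t\<close> again. It is nonempty because no arc stays inside a class.\<close>

lemma cover_path_decomposition:
  assumes q: "cycle_cover q" and hit: "\<forall>u\<in>moved q. hits s q u"
    and s_moved: "\<And>t. t \<in> V \<Longrightarrow> cls t = s \<Longrightarrow> q t \<noteq> t"
  obtains P where
    "\<And>t. t \<in> V \<Longrightarrow> cls t = s \<Longrightarrow> P t \<noteq> [] \<and> distinct (P t) \<and> successively arc (P t)"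
    "\<And>t t'. t \<in> V \<Longrightarrow> cls t = s \<Longrightarrow> t' \<in> V \<Longrightarrow> cls t' = s \<Longrightarrow> t \<noteq> t' \<Longrightarrow> set (P t) \<inter> set (P t') = {}"
    "(\<Union>t\<in>{t\<in>V. cls t = s}. set (P t)) = {u \<in> moved q. cls u \<noteq> s}"
proof -
  have pp: "q permutes V" and qarc: "\<And>u. q u \<noteq> u \<Longrightarrow> arc u (q u)"
    using q by (auto simp: cycle_cover_def)
  have inj: "q x = q y \<longleftrightarrow> x = y" for x y
    using permutes_inj[OF pp] by (auto dest: injD)
  have injn: "(q ^^ n) x = (q ^^ n) y \<longleftrightarrow> x = y" for n x y
    by (induction n) (auto simp: inj)
  have moved_n: "(q ^^ n) u \<in> moved q \<longleftrightarrow> u \<in> moved q" for n u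
    by (induction n) (auto simp: inj)
  define d where "d u = (LEAST n. cls ((q ^^ n) u) = s)" for u
  have d_s: "cls ((q ^^ d u) u) = s" if "u \<in> moved q" for u
    unfolding d_def by (rule LeastI_ex) (use hit that hits_funpow_exists in blast)
  have d_less: "cls ((q ^^ n) u) \<noteq> s" if "n < d u" for n u
    using that not_less_Least unfolding d_def by blast
  \<comment> \<open>The count starts at \<open>q t\<close>, since \<open>d t = 0\<close> for
    \<open>t\<close> in class \<open>s\<close>.\<close>
  define P where "P t = map (\<lambda>i. (q ^^ i) (q t)) [0..<d (q t)]" for t
  \<comment> \<open>Cancelling the common steps puts \<open>t\<close> itself \<open>j - i\<close>
    steps after \<open>t'\<close>. Unless \<open>i = j\<close>, it would lie on the stretch of
    \<open>t'\<close>, where no vertex of class \<open>s\<close> occurs.\<close>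
  have inj_le: "t = t' \<and> i = j" if "i \<le> j" "j < d (q t')" "(q ^^ i) (q t) = (q ^^ j) (q t')" "cls t = s"
    for i j t t'
  proof -
    have "(q ^^ j) (q t') = (q ^^ i) ((q ^^ (j - i)) (q t'))"
      using that(1) by (metis comp_apply funpow_add le_add_diff_inverse)
    then have "q t = q ((q ^^ (j - i)) t')"
      using that(3) injn by (simp add: funpow_swap1)
    then have t: "t = (q ^^ (j - i)) t'" by (simp add: inj)
    show ?thesis
    proof (cases "j - i")
      case 0
      then show ?thesis using t that(1) by simp
    next
      case (Suc m)
      then have "t = (q ^^ m) (q t')" using t by (simp add: funpow_swap1)
      then show ?thesis using d_less[of m "q t'"] that Suc by simp
    qed
  qed
  have inj_P: "t = t' \<and> i = j" if "i < d (q t)" "j < d (q t')" "(q ^^ i) (q t) = (q ^^ j) (q t')"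
      "cls t = s" "cls t' = s" for i j t t'
    using that inj_le[of i j t' t] inj_le[of j i t t'] by (metis nat_le_linear)
  have 1: "P t \<noteq> [] \<and> distinct (P t) \<and> successively arc (P t)" if t: "t \<in> V" "cls t = s" for t
  proof (intro conjI)
    have tm: "q t \<in> moved q" using s_moved[OF t] by (simp add: inj)
    have "cls (q t) \<noteq> s"
      using qarc[OF s_moved[OF t]] t irrefl by (auto simp: arc_def)
    then have "d (q t) \<noteq> 0" using d_s[OF tm] by (metis funpow_0)
    then show "P t \<noteq> []" by (simp add: P_def)
    show "distinct (P t)"
      unfolding P_def by (auto simp: distinct_map inj_on_def dest: inj_P[OF _ _ _ t(2) t(2)])
    show "successively arc (P t)"
      using qarc moved_n tm by (auto simp: P_def successively_conv_nth)
  qed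
  have 2: "set (P t) \<inter> set (P t') = {}"
    if "t \<in> V" "cls t = s" "t' \<in> V" "cls t' = s" "t \<noteq> t'" for t t'
    using that inj_P[of _ t _ t'] by (auto simp: P_def)
  \<comment> \<open>\<open>hits\<close> looks forward, whereas a vertex of class \<open>s\<close>
    behind \<open>u\<close> is wanted. When the induction offers only \<open>q u\<close> itself, the
    walk goes from there around the cycle to \<open>u\<close>.\<close>
  have backward: "\<exists>n. \<exists>t\<in>moved q. cls t = s \<and> (q ^^ n) t = u" if "u \<in> moved q" for u
  proof -
    have "hits s q u" using that hit by blast
    then show ?thesis using that
    proof (induction rule: hits.induct)
      case (here u)
      then show ?case by (intro exI[of _ 0]) auto
    next
      case (step u)
      then obtain n t where nt: "t \<in> moved q" "cls t = s" "(q ^^ n) t = q u"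
        by (auto simp: inj)
      show ?case
      proof (cases n)
        case 0
        moreover obtain m where "(q ^^ m) (q u) = u"
          using permutes_funpow_cycle[OF pp finite_V] by blast
        ultimately show ?thesis using nt by auto
      next
        case (Suc m)
        then show ?thesis using nt inj by auto
      qed
    qed
  qed
  have "u \<in> (\<Union>t\<in>{t\<in>V. cls t = s}. set (P t))" if u: "u \<in> moved q" "cls u \<noteq> s" for u
  proof -
    let ?R = "\<lambda>n. \<exists>t\<in>moved q. cls t = s \<and> (q ^^ n) t = u"
    \<comment> \<open>The least \<open>n\<close> singles out the last vertex of class
      \<open>s\<close> before \<open>u\<close>, so that \<open>u\<close> lies on the stretch
      following it.\<close>
    define n where "n = (LEAST n. ?R n)"
    have "?R n" unfolding n_def by (rule LeastI_ex) (rule backward[OF u(1)])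
    then obtain t where t: "t \<in> moved q" "cls t = s" "(q ^^ n) t = u" by blast
    have least: "\<not> ?R m" if "m < n" for m
      using that not_less_Least unfolding n_def by blast
    have "n \<noteq> 0" using t u by (metis funpow_0)
    then obtain m where m: "n = Suc m" by (cases n) auto
    then have um: "u = (q ^^ m) (q t)" using t by (simp add: funpow_swap1)
    have "m < d (q t)"
    proof (rule ccontr)
      assume "\<not> m < d (q t)"
      then have le: "d (q t) \<le> m" by simp
      have qt: "q t \<in> moved q" using t(1) by (simp add: inj)
      have "(q ^^ (m - d (q t))) ((q ^^ d (q t)) (q t)) = u"
        using le um by (metis comp_apply funpow_add le_add_diff_inverse2)
      moreover have "(q ^^ d (q t)) (q t) \<in> moved q" using qt moved_n by blast
      ultimately have "?R (m - d (q t))" using d_s[OF qt] by blast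
      moreover have "m - d (q t) < n" using m by simp
      ultimately show False using least by blast
    qed
    moreover have "t \<in> V" using t(1) moved_subset[OF q] by blast
    ultimately show ?thesis using t um by (auto simp: P_def)
  qed
  moreover have "u \<in> moved q \<and> cls u \<noteq> s" if t: "t \<in> V" "cls t = s" and u: "u \<in> set (P t)" for u t
  proof -
    obtain i where "i < d (q t)" "u = (q ^^ i) (q t)" using u by (auto simp: P_def)
    moreover have "q t \<in> moved q" using s_moved[OF t] by (simp add: inj)
    ultimately show ?thesis using moved_n d_less by blast
  qed
  ultimately have 3: "(\<Union>t\<in>{t\<in>V. cls t = s}. set (P t)) = {u \<in> moved q. cls u \<noteq> s}" by blast
  show thesis by (rule that[OF 1 2 3])
qed

end

section \<open>Path subdigraphs\<close>

text \<open>The closed lists are glued into one successor map. It is controlled only on their union,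
  which is all that \<open>maximal_cover_class\<close> asks of a competitor.\<close>

lemma disjoint_cycles:
  assumes "\<And>t. t \<in> I \<Longrightarrow> distinct (L t) \<and> successively P (L t) \<and> P (last (L t)) (hd (L t))"
    and disj: "\<And>t t'. t \<in> I \<Longrightarrow> t' \<in> I \<Longrightarrow> t \<noteq> t' \<Longrightarrow> set (L t) \<inter> set (L t') = {}"
  obtains f where "inj_on f (\<Union>t\<in>I. set (L t))" "f ` (\<Union>t\<in>I. set (L t)) \<subseteq> (\<Union>t\<in>I. set (L t))"
    "\<And>x. x \<in> (\<Union>t\<in>I. set (L t)) \<Longrightarrow> P x (f x)"
proof -
  define f where "f x = cycle_of_list (L (THE t. t \<in> I \<and> x \<in> set (L t))) x" for x
  have f: "f x = cycle_of_list (L t) x" if "t \<in> I" "x \<in> set (L t)" for x t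
  proof -
    have "(THE t. t \<in> I \<and> x \<in> set (L t)) = t"
      using that disj by (intro the_equality) blast+
    then show ?thesis by (simp add: f_def)
  qed
  have f_in: "f x \<in> set (L t)" if "t \<in> I" "x \<in> set (L t)" for x t
    using that f[OF that] permutes_in_image[OF cycle_permutes[of "L t"], of x] by simp
  have "inj_on f (\<Union>t\<in>I. set (L t))"
  proof (rule inj_onI)
    fix x y assume x: "x \<in> (\<Union>t\<in>I. set (L t))" and y: "y \<in> (\<Union>t\<in>I. set (L t))" and eq: "f x = f y"
    obtain t where t: "t \<in> I" "x \<in> set (L t)" using x by blast
    obtain t' where t': "t' \<in> I" "y \<in> set (L t')" using y by blast
    have "t = t'" using f_in[OF t] f_in[OF t'] eq disj[OF t(1) t'(1)] by auto
    then have "cycle_of_list (L t) x = cycle_of_list (L t) y"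
      using f[OF t] f[OF t'] eq by simp
    then show "x = y" using permutes_inj[OF cycle_permutes[of "L t"]] by (auto dest: injD)
  qed
  moreover have "f ` (\<Union>t\<in>I. set (L t)) \<subseteq> (\<Union>t\<in>I. set (L t))"
    using f_in by blast
  moreover have "P x (f x)" if x: "x \<in> (\<Union>t\<in>I. set (L t))" for x
  proof -
    obtain t where t: "t \<in> I" "x \<in> set (L t)" using x by blast
    then show ?thesis using f[OF t] cycle_of_list_successively[of "L t" P x] assms(1)[OF t(1)] by simp
  qed
  ultimately show thesis using that by blast
qed

text \<open>With \<open>g\<close> the class of a vertex, this cuts a path where it changes class. A
  new first vertex either joins the leading block or, by the second assumption, opens a block
  related to it.\<close>

lemma split_into_blocks:
  assumes "successively E p"
    and "\<And>x y. x \<in> set p \<Longrightarrow> y \<in> set p \<Longrightarrow> E x y \<Longrightarrow> g x \<noteq> g y \<Longrightarrow> R (g x) (g y)"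
  shows "\<exists>bs. concat bs = p \<and> [] \<notin> set bs \<and>
    (\<forall>b\<in>set bs. successively E b \<and> (\<forall>x\<in>set b. g (hd b) = g x)) \<and>
    successively (\<lambda>b b'. R (g (hd b)) (g (hd b'))) bs"
  using assms
proof (induction p)
  case Nil
  show ?case by (intro exI[of _ "[]"]) simp
next
  case (Cons x p)
  have "successively E p" using Cons.prems(1) by (auto simp: successively_Cons)
  then obtain bs where bs: "concat bs = p" "[] \<notin> set bs"
    "\<forall>b\<in>set bs. successively E b \<and> (\<forall>x\<in>set b. g (hd b) = g x)"
    "successively (\<lambda>b b'. R (g (hd b)) (g (hd b'))) bs"
    using Cons.IH Cons.prems(2) by auto
  show ?case
  proof (cases bs)
    case Nil
    then show ?thesis using bs(1) by (intro exI[of _ "[[x]]"]) simp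
  next
    case (Cons b bs')
    then have b: "b \<noteq> []" "p \<noteq> []" "hd p = hd b" using bs(1,2) by auto
    then have E: "E x (hd b)" using Cons.prems(1) by (simp add: successively_Cons)
    show ?thesis
    proof (cases "g x = g (hd b)")
      case True
      then show ?thesis using bs Cons b E
        by (intro exI[of _ "(x # b) # bs'"]) (auto simp: successively_Cons)
    next
      case False
      then have "R (g x) (g (hd b))"
        using Cons.prems(2)[of x "hd b"] E b by (metis hd_in_set list.set_intros)
      then show ?thesis using bs Cons by (intro exI[of _ "[x] # bs"]) (auto simp: successively_Cons)
    qed
  qed
qed

text \<open>The converse of cutting into blocks: each vertex of a path is replaced by a path of its
  own.\<close>

lemma successively_concat_map:
  assumes "successively A p"
    and "\<And>x. x \<in> set p \<Longrightarrow> f x \<noteq> [] \<and> successively E (f x)"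
    and "\<And>x y. x \<in> set p \<Longrightarrow> y \<in> set p \<Longrightarrow> A x y \<Longrightarrow> E (last (f x)) (hd (f y))"
  shows "successively E (concat (map f p))"
  using assms
proof (induction p)
  case (Cons x p)
  show ?case
  proof (cases p)
    case Nil
    then show ?thesis using Cons.prems(2) by simp
  next
    case (Cons y p')
    have "successively E (concat (map f p))"
      using Cons.IH Cons.prems by (auto simp: successively_Cons)
    moreover have "E (last (f x)) (hd (f y))"
      using Cons.prems Cons by (auto simp: successively_Cons)
    ultimately show ?thesis using Cons Cons.prems(2)[of x] Cons.prems(2)[of y]
      by (auto simp: successively_append_iff)
  qed
qed simp

lemma set_vwalk_arcs_subset_iff:
  "set (vwalk_arcs p) \<subseteq> A \<longleftrightarrow> successively (\<lambda>x y. (x, y) \<in> A) p"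
  by (induction p rule: vwalk_arcs.induct) auto

lemma vpath_with_proj_iff:
  "vpath p (with_proj D) \<longleftrightarrow> p \<noteq> [] \<and> distinct p \<and> set p \<subseteq> pverts D \<and>
     successively (\<lambda>x y. (x, y) \<in> parcs D) p"
  by (auto simp: vpath_def vwalk_def set_vwalk_arcs_subset_iff)

lemma covered_verts_subset:
  "k_path_subdigraph D k F \<Longrightarrow> covered_verts F \<subseteq> pverts D"
  by (auto simp: k_path_subdigraph_def covered_verts_def vpath_with_proj_iff)

section \<open>Increasing the number of paths\<close>

text \<open>An uncovered vertex serves as a new one-vertex path. If everything is covered, having
  fewer paths than vertices forces some path to have at least two vertices, and its first vertex can
  be split off.\<close>

lemma k_path_subdigraph_Suc:
  assumes F: "k_path_subdigraph D k F" and k: "k < card (pverts D)"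
  shows "\<exists>F'. k_path_subdigraph D (Suc k) F' \<and> covered_verts F \<subseteq> covered_verts F'"
proof (cases "covered_verts F = pverts D")
  case False
  then obtain v where v: "v \<in> pverts D" "v \<notin> covered_verts F"
    using covered_verts_subset[OF F] by blast
  then have "[v] \<notin> F" by (auto simp: covered_verts_def)
  then have "k_path_subdigraph D (Suc k) (insert [v] F)"
    using F v unfolding k_path_subdigraph_def
    by (auto simp: vpath_with_proj_iff pairwise_insert covered_verts_def disjnt_def)
  then show ?thesis by (auto simp: covered_verts_def)
next
  case True
  have F': "finite F" "card F = k" "\<And>p. p \<in> F \<Longrightarrow> vpath p (with_proj D)"
    "pairwise (\<lambda>p q. disjnt (set p) (set q)) F"
    using F by (auto simp: k_path_subdigraph_def)
  have "\<exists>p\<in>F. length p \<noteq> 1"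
  proof (rule ccontr)
    assume "\<not> ?thesis"
    then have "card (set p) \<le> 1" if "p \<in> F" for p
      using that card_length[of p] by auto
    then have "(\<Sum>p\<in>F. card (set p)) \<le> (\<Sum>p\<in>F. 1)" by (intro sum_mono) auto
    moreover have "card (covered_verts F) \<le> (\<Sum>p\<in>F. card (set p))"
      unfolding covered_verts_def by (rule card_UN_le[OF F'(1)])
    ultimately show False using True k F'(2) by simp
  qed
  then obtain p where p: "p \<in> F" "length p \<noteq> 1" by blast
  then obtain x y zs where xy: "p = x # y # zs"
    using F'(3)[OF p(1)] by (cases p; cases "tl p") (auto simp: vpath_with_proj_iff)
  have px: "vpath [x] (with_proj D)" "vpath (y # zs) (with_proj D)" "x \<notin> set (y # zs)"
    using F'(3)[OF p(1)] by (auto simp: vpath_with_proj_iff xy)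
  have disj: "disjnt (set p) (set q)" if "q \<in> F - {p}" for q
    using F'(4) p(1) that by (auto simp: pairwise_def)
  have new: "[x] \<notin> F - {p}" "y # zs \<notin> insert [x] (F - {p})"
    using disj[of "[x]"] disj[of "y # zs"] px(3) by (auto simp: xy)
  let ?F = "insert (y # zs) (insert [x] (F - {p}))"
  have "card ?F = Suc (Suc (card (F - {p})))"
    using new F'(1) by simp
  then have "card ?F = Suc k"
    using F'(1,2) p(1) by (metis card_Suc_Diff1)
  moreover have "pairwise (\<lambda>p q. disjnt (set p) (set q)) ?F"
    using F'(4) disj px(3) unfolding pairwise_insert
    by (auto simp: xy disjnt_sym disjnt_def intro: pairwise_subset)
  ultimately have "k_path_subdigraph D (Suc k) ?F"
    using F'(1,3) px by (auto simp: k_path_subdigraph_def)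
  moreover have "covered_verts F \<subseteq> covered_verts ?F"
    by (auto simp: covered_verts_def xy)
  ultimately show ?thesis by blast
qed

lemma k_path_subdigraph_mono:
  assumes F: "k_path_subdigraph D k F" and "k \<le> m" "m \<le> card (pverts D)"
  shows "\<exists>F'. k_path_subdigraph D m F' \<and> covered_verts F \<subseteq> covered_verts F'"
  using assms(2,3)
proof (induction m rule: dec_induct)
  case base
  then show ?case using F by blast
next
  case (step m)
  then obtain F' where F': "k_path_subdigraph D m F'" "covered_verts F \<subseteq> covered_verts F'" by auto
  then show ?case using k_path_subdigraph_Suc[OF F'(1)] step.prems by fastforce
qed

text \<open>Systems with fewer than \<open>m\<close> paths can be enlarged to \<open>m\<close> paths
  without losing vertices, so a best one with exactly \<open>m\<close> paths beats them as well. The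
  comparison with smaller \<open>k\<close> serves competitors that meet an \<open>H i\<close> in
  fewer blocks.\<close>

lemma best_k_path_subdigraph_exists:
  assumes fin: "finite (pverts D)" and m: "m \<le> card (pverts D)"
  obtains G where "k_path_subdigraph D m G"
    "\<And>k F. k_path_subdigraph D k F \<Longrightarrow> k \<le> m \<Longrightarrow> card (covered_verts F) \<le> card (covered_verts G)"
proof -
  let ?C = "{card (covered_verts G) | G. k_path_subdigraph D m G}"
  have le: "card (covered_verts G) \<le> card (pverts D)" if "k_path_subdigraph D l G" for l G
    using covered_verts_subset[OF that] fin by (rule card_mono[rotated])
  have "?C \<subseteq> {..card (pverts D)}" using le by auto
  then have finC: "finite ?C" by (rule finite_subset) simp
  have "k_path_subdigraph D 0 {}" by (simp add: k_path_subdigraph_def)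
  then have "?C \<noteq> {}" using k_path_subdigraph_mono[OF _ _ m] by blast
  then have "Max ?C \<in> ?C" using finC by (intro Max_in)
  then obtain G where G: "k_path_subdigraph D m G" "card (covered_verts G) = Max ?C" by auto
  show thesis
  proof (rule that[OF G(1)])
    fix k F assume F: "k_path_subdigraph D k F" "k \<le> m"
    obtain F' where F': "k_path_subdigraph D m F'" "covered_verts F \<subseteq> covered_verts F'"
      using k_path_subdigraph_mono[OF F m] by blast
    have "finite (covered_verts F')" using covered_verts_subset[OF F'(1)] fin finite_subset by blast
    then have "card (covered_verts F) \<le> card (covered_verts F')" using F'(2) by (rule card_mono)
    also have "\<dots> \<le> Max ?C" using F'(1) finC by (intro Max_ge) auto
    finally show "card (covered_verts F) \<le> card (covered_verts G)" using G(2) by simp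
  qed
qed

section \<open>Semicomplete compositions\<close>

locale semicomplete_composition =
  fixes T :: "'i pair_pre_digraph" and H :: "'i \<Rightarrow> 'a pair_pre_digraph"
  assumes T: "pair_digraph T"
    and H: "\<And>i. i \<in> pverts T \<Longrightarrow> pair_digraph (H i)"
    and disjoint: "\<And>i j. i \<in> pverts T \<Longrightarrow> j \<in> pverts T \<Longrightarrow> i \<noteq> j \<Longrightarrow> pverts (H i) \<inter> pverts (H j) = {}"
    and semicomplete: "semicomplete T"
begin

abbreviation Q :: "'a pair_pre_digraph" where
  "Q \<equiv> composition T H"

definition idx :: "'a \<Rightarrow> 'i" where
  "idx x = (THE i. i \<in> pverts T \<and> x \<in> pverts (H i))"

lemma idx_eq: "i \<in> pverts T \<Longrightarrow> x \<in> pverts (H i) \<Longrightarrow> idx x = i"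
  unfolding idx_def using disjoint by (intro the_equality) blast+

lemma pverts_Q: "pverts Q = (\<Union>i\<in>pverts T. pverts (H i))"
  by (simp add: composition_def)

lemma idx_in:
  assumes "x \<in> pverts Q"
  shows "idx x \<in> pverts T" "x \<in> pverts (H (idx x))"
  using assms idx_eq by (auto simp: pverts_Q)

lemma finite_pverts: "finite (pverts T)" "i \<in> pverts T \<Longrightarrow> finite (pverts (H i))" "finite (pverts Q)"
proof -
  show 1: "finite (pverts T)"
    using T by (simp add: pair_digraph_def pair_fin_digraph_def pair_fin_digraph_axioms_def)
  show 2: "finite (pverts (H i))" if "i \<in> pverts T" for i
    using H[OF that] by (simp add: pair_digraph_def pair_fin_digraph_def pair_fin_digraph_axioms_def)
  show "finite (pverts Q)" using 1 2 by (simp add: pverts_Q)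
qed

lemma parcs_T:
  assumes "(i, j) \<in> parcs T"
  shows "i \<in> pverts T" "j \<in> pverts T" "i \<noteq> j"
proof -
  interpret pair_digraph T by (rule T)
  show "i \<in> pverts T" "j \<in> pverts T"
    using assms in_arcsD1 in_arcsD2 by blast+
  show "i \<noteq> j" using assms no_loops[of "(i, j)"] by simp
qed

lemma parcs_H:
  assumes "i \<in> pverts T" "(x, y) \<in> parcs (H i)"
  shows "x \<in> pverts (H i)" "y \<in> pverts (H i)"
proof -
  interpret pair_digraph "H i" by (rule H) fact
  show "x \<in> pverts (H i)" "y \<in> pverts (H i)"
    using assms(2) in_arcsD1 in_arcsD2 by blast+
qed

lemma parcs_Q_iff:
  assumes "x \<in> pverts Q" "y \<in> pverts Q"
  shows "(x, y) \<in> parcs Q \<longleftrightarrow>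
    (if idx x = idx y then (x, y) \<in> parcs (H (idx x)) else (idx x, idx y) \<in> parcs T)"
proof
  assume "(x, y) \<in> parcs Q"
  then consider i where "i \<in> pverts T" "(x, y) \<in> parcs (H i)"
    | i j where "x \<in> pverts (H i)" "y \<in> pverts (H j)" "(i, j) \<in> parcs T"
    by (auto simp: composition_def)
  then show "if idx x = idx y then (x, y) \<in> parcs (H (idx x)) else (idx x, idx y) \<in> parcs T"
  proof cases
    case 1
    then have "idx x = i" "idx y = i" using parcs_H[OF 1] idx_eq by auto
    then show ?thesis using 1 by simp
  next
    case 2
    then have "idx x = i" "idx y = j" using parcs_T[OF 2(3)] idx_eq by auto
    then show ?thesis using 2 parcs_T(3) by auto
  qed
next
  assume "if idx x = idx y then (x, y) \<in> parcs (H (idx x)) else (idx x, idx y) \<in> parcs T"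
  then show "(x, y) \<in> parcs Q"
    using idx_in[OF assms(1)] idx_in[OF assms(2)] by (auto simp: composition_def split: if_splits)
qed

text \<open>The class \<^const>\<open>None\<close> holds one additional vertex per path; closing every path of a
  \<open>k\<close>-path subdigraph through its own additional vertex turns it into a union of cycles.\<close>

definition vert_class :: "'a + nat \<Rightarrow> 'i option" where
  "vert_class = case_sum (\<lambda>x. Some (idx x)) (\<lambda>_. None)"

text \<open>Arcs in both directions between \<open>None\<close> and the other classes let every path
  be closed and preserve semicompleteness. As \<open>None\<close> has no arc to itself, additional
  vertices never follow each other, so cutting at them leaves no empty path.\<close>

definition class_arc :: "'i option \<Rightarrow> 'i option \<Rightarrow> bool" where
  "class_arc a b = (case a of None \<Rightarrow> b \<noteq> None
     | Some i \<Rightarrow> (case b of None \<Rightarrow> True | Some j \<Rightarrow> (i, j) \<in> parcs T))"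

definition ext_verts :: "nat \<Rightarrow> ('a + nat) set" where
  "ext_verts k = Inl ` pverts Q \<union> Inr ` {..<k}"

lemma vert_class_simps [simp]:
  "vert_class (Inl x) = Some (idx x)" "vert_class (Inr t) = None"
  by (simp_all add: vert_class_def)

lemma class_arc_simps [simp]:
  "class_arc (Some i) (Some j) \<longleftrightarrow> (i, j) \<in> parcs T"
  "class_arc None (Some j)" "class_arc (Some i) None" "\<not> class_arc None None"
  by (simp_all add: class_arc_def)

lemma extended_semicomplete_ext: "extended_semicomplete (ext_verts k) vert_class class_arc"
proof
  show "finite (ext_verts k)" using finite_pverts by (simp add: ext_verts_def)
  show "\<not> class_arc i i" for i using parcs_T(3) by (cases i) auto
  have total: "(i, j) \<in> parcs T \<or> (j, i) \<in> parcs T" if "i \<in> pverts T" "j \<in> pverts T" "i \<noteq> j" for i j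
    using semicomplete that unfolding semicomplete_def by blast
  fix u w assume "u \<in> ext_verts k" "w \<in> ext_verts k" "vert_class u \<noteq> vert_class w"
  then show "class_arc (vert_class u) (vert_class w) \<or> class_arc (vert_class w) (vert_class u)"
    using total idx_in(1) unfolding ext_verts_def by (cases u; cases w) auto
qed

section \<open>Contracting a path subdigraph to cycles\<close>

text \<open>Each block of a path inside one \<open>H i\<close> is represented by its first vertex.
  So \<open>S\<close> has as many vertices of class \<open>i\<close> as there are blocks in
  \<open>H i\<close>, and these blocks are disjoint paths of \<open>H i\<close> covering exactly
  what \<open>F\<close> covers there.\<close>

lemma contract_to_cycles:
  assumes F: "k_path_subdigraph Q k F"
  obtains S f where "S \<subseteq> ext_verts k" "inj_on f S" "f ` S \<subseteq> S"
    "\<And>u. u \<in> S \<Longrightarrow> class_arc (vert_class u) (vert_class (f u))"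
    "Inr ` {..<k} \<subseteq> S"
    "\<And>i. i \<in> pverts T \<Longrightarrow> \<exists>G. k_path_subdigraph (H i) (card {u \<in> S. vert_class u = Some i}) G \<and>
       covered_verts G = pverts (H i) \<inter> covered_verts F"
proof -
  have F': "finite F" "card F = k" "\<And>p. p \<in> F \<Longrightarrow> vpath p (with_proj Q)"
    "pairwise (\<lambda>p q. disjnt (set p) (set q)) F"
    using F by (auto simp: k_path_subdigraph_def)
  obtain e where e: "bij_betw e {..<k} F"
    using ex_bij_betw_nat_finite[OF F'(1)] F'(2) by (auto simp: atLeast0LessThan)
  have eF: "e t \<in> F" if "t < k" for t using e that by (auto simp: bij_betw_def)
  have path: "e t \<noteq> []" "distinct (e t)" "set (e t) \<subseteq> pverts Q"
    "successively (\<lambda>x y. (x, y) \<in> parcs Q) (e t)" if "t < k" for t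
    using F'(3)[OF eF[OF that]] by (auto simp: vpath_with_proj_iff)
  have e_disj: "set (e t) \<inter> set (e t') = {}" if "t < k" "t' < k" "t \<noteq> t'" for t t'
  proof -
    have "e t \<noteq> e t'" using e that by (auto simp: bij_betw_def inj_on_def)
    then show ?thesis using F'(4) eF that by (auto simp: pairwise_def disjnt_def)
  qed
  have ex_blocks: "\<exists>bs. concat bs = e t \<and> [] \<notin> set bs \<and>
    (\<forall>b\<in>set bs. successively (\<lambda>x y. (x, y) \<in> parcs Q) b \<and> (\<forall>x\<in>set b. idx (hd b) = idx x)) \<and>
    successively (\<lambda>b b'. (idx (hd b), idx (hd b')) \<in> parcs T) bs" if "t < k" for t
  proof (rule split_into_blocks[OF path(4)[OF that], where R = "\<lambda>i j. (i, j) \<in> parcs T"])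
    fix x y assume "x \<in> set (e t)" "y \<in> set (e t)" "(x, y) \<in> parcs Q" "idx x \<noteq> idx y"
    then show "(idx x, idx y) \<in> parcs T" using parcs_Q_iff[of x y] path(3)[OF that] by auto
  qed
  define bs where "bs t = (SOME bs. concat bs = e t \<and> [] \<notin> set bs \<and>
    (\<forall>b\<in>set bs. successively (\<lambda>x y. (x, y) \<in> parcs Q) b \<and> (\<forall>x\<in>set b. idx (hd b) = idx x)) \<and>
    successively (\<lambda>b b'. (idx (hd b), idx (hd b')) \<in> parcs T) bs)" for t
  have bs: "concat (bs t) = e t" "[] \<notin> set (bs t)"
    "\<And>b. b \<in> set (bs t) \<Longrightarrow> successively (\<lambda>x y. (x, y) \<in> parcs Q) b"
    "\<And>b x. b \<in> set (bs t) \<Longrightarrow> x \<in> set b \<Longrightarrow> idx (hd b) = idx x"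
    "successively (\<lambda>b b'. (idx (hd b), idx (hd b')) \<in> parcs T) (bs t)" if "t < k" for t
    using someI_ex[OF ex_blocks[OF that]] unfolding bs_def[symmetric] by blast+
  have bs_set: "set b \<subseteq> set (e t)" if "t < k" "b \<in> set (bs t)" for t b
    using that bs(1)[OF that(1), symmetric] by auto
  have ne: "b \<noteq> []" if "t < k" "b \<in> set (bs t)" for t b
    using bs(2) that by metis
  have hd_e: "hd b \<in> set (e t)" if "t < k" "b \<in> set (bs t)" for t b
    using bs_set[OF that] ne[OF that] by auto
  have dist: "distinct (bs t)" "\<And>b. b \<in> set (bs t) \<Longrightarrow> distinct b"
    "\<And>b b'. b \<in> set (bs t) \<Longrightarrow> b' \<in> set (bs t) \<Longrightarrow> b \<noteq> b' \<Longrightarrow> set b \<inter> set b' = {}" if "t < k" for t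
    using path(2)[OF that] bs(2)[OF that] unfolding bs(1)[OF that, symmetric] distinct_concat_iff
    by auto
  define BS where "BS = (\<Union>t<k. set (bs t))"
  have BS_disj: "set b \<inter> set b' = {}" if "b \<in> BS" "b' \<in> BS" "b \<noteq> b'" for b b'
  proof -
    obtain t t' where t: "t < k" "b \<in> set (bs t)" and t': "t' < k" "b' \<in> set (bs t')"
      using \<open>b \<in> BS\<close> \<open>b' \<in> BS\<close> by (auto simp: BS_def)
    show ?thesis
    proof (cases "t = t'")
      case True
      then show ?thesis using dist(3)[OF t(1) t(2)] t' \<open>b \<noteq> b'\<close> by auto
    next
      case False
      then show ?thesis using bs_set[OF t] bs_set[OF t'] e_disj[OF t(1) t'(1)] by blast
    qed
  qed
  have BS_ne: "b \<noteq> []" if "b \<in> BS" for b using that ne by (auto simp: BS_def)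
  have hd_inj: "inj_on hd BS"
  proof (rule inj_onI)
    fix b b' assume b: "b \<in> BS" "b' \<in> BS" "hd b = hd b'"
    then have "hd b \<in> set b \<inter> set b'" using BS_ne by (metis IntI hd_in_set)
    then show "b = b'" using BS_disj b(1,2) by blast
  qed
  \<comment> \<open>Read cyclically, this is the contracted path closed through its additional
    vertex.\<close>
  define L where "L t = Inr t # map (Inl \<circ> hd) (bs t)" for t :: nat
  let ?A = "\<lambda>u w. class_arc (vert_class u) (vert_class w)"
  have L1: "distinct (L t) \<and> successively ?A (L t) \<and> ?A (last (L t)) (hd (L t))" if t: "t \<in> {..<k}" for t
  proof -
    have t: "t < k" using t by simp
    have "inj_on hd (set (bs t))" using hd_inj t by (auto simp: BS_def intro: inj_on_subset)
    then have "inj_on (Inl \<circ> hd) (set (bs t))" by (auto simp: inj_on_def)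
    then have "distinct (L t)" using dist(1)[OF t] by (auto simp: L_def distinct_map)
    moreover have "bs t \<noteq> []" using bs(1)[OF t] path(1)[OF t] by auto
    ultimately show ?thesis using bs(5)[OF t]
      by (auto simp: L_def successively_Cons successively_map hd_map last_map)
  qed
  have L2: "set (L t) \<inter> set (L t') = {}" if "t \<in> {..<k}" "t' \<in> {..<k}" "t \<noteq> t'" for t t'
  proof -
    have "hd b \<noteq> hd b'" if "b \<in> set (bs t)" "b' \<in> set (bs t')" for b b'
      using hd_e[OF _ that(1)] hd_e[OF _ that(2)] e_disj[of t t'] \<open>t \<in> {..<k}\<close> \<open>t' \<in> {..<k}\<close> \<open>t \<noteq> t'\<close>
      by (metis disjoint_iff lessThan_iff)
    then show ?thesis using \<open>t \<noteq> t'\<close> by (auto simp: L_def)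
  qed
  define S where "S = (\<Union>t\<in>{..<k}. set (L t))"
  obtain f where f: "inj_on f S" "f ` S \<subseteq> S" "\<And>u. u \<in> S \<Longrightarrow> ?A u (f u)"
    unfolding S_def by (rule disjoint_cycles[OF L1 L2]) blast+
  have S_eq: "S = Inr ` {..<k} \<union> (Inl \<circ> hd) ` BS"
    by (auto simp: S_def L_def BS_def)
  show thesis
  proof (rule that[OF _ f])
    have "hd b \<in> pverts Q" if "b \<in> BS" for b
      using that hd_e path(3) unfolding BS_def by blast
    then show "S \<subseteq> ext_verts k" by (auto simp: S_eq ext_verts_def)
    show "Inr ` {..<k} \<subseteq> S" by (auto simp: S_eq)
    fix i assume i: "i \<in> pverts T"
    define G where "G = {b \<in> BS. idx (hd b) = i}"
    have "{u \<in> S. vert_class u = Some i} = (Inl \<circ> hd) ` G"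
      by (auto simp: S_eq G_def)
    moreover have "inj_on (Inl \<circ> hd) G" using hd_inj by (auto simp: inj_on_def G_def)
    ultimately have card_G: "card {u \<in> S. vert_class u = Some i} = card G"
      by (metis card_image)
    have idx_G: "idx x = i" "x \<in> pverts (H i)" "x \<in> pverts Q" if "b \<in> G" "x \<in> set b" for b x
    proof -
      obtain t where t: "t < k" "b \<in> set (bs t)" using \<open>b \<in> G\<close> by (auto simp: G_def BS_def)
      show "idx x = i" using bs(4)[OF t \<open>x \<in> set b\<close>] \<open>b \<in> G\<close> by (auto simp: G_def)
      show "x \<in> pverts Q" using bs_set[OF t] path(3)[OF t(1)] \<open>x \<in> set b\<close> by blast
      then show "x \<in> pverts (H i)" using idx_in(2) \<open>idx x = i\<close> by blast
    qed
    have "vpath b (with_proj (H i))" if b: "b \<in> G" for b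
    proof -
      obtain t where t: "t < k" "b \<in> set (bs t)" using b by (auto simp: G_def BS_def)
      have "successively (\<lambda>x y. (x, y) \<in> parcs (H i)) b"
        using bs(3)[OF t] by (rule successively_mono) (use idx_G[OF b] parcs_Q_iff in auto)
      then show ?thesis
        using ne[OF t] dist(2)[OF t] idx_G[OF b] by (auto simp: vpath_with_proj_iff)
    qed
    moreover have "finite G" by (simp add: G_def BS_def)
    moreover have "pairwise (\<lambda>p q. disjnt (set p) (set q)) G"
      using BS_disj by (auto simp: pairwise_def disjnt_def G_def)
    ultimately have "k_path_subdigraph (H i) (card G) G"
      by (simp add: k_path_subdigraph_def)
    moreover have "covered_verts G = pverts (H i) \<inter> covered_verts F"
    proof (intro equalityI subsetI)
      fix x assume "x \<in> covered_verts G"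
      then obtain b where b: "b \<in> G" "x \<in> set b" by (auto simp: covered_verts_def)
      then obtain t where t: "t < k" "b \<in> set (bs t)" by (auto simp: G_def BS_def)
      then have "x \<in> set (e t)" using bs_set b(2) by blast
      then show "x \<in> pverts (H i) \<inter> covered_verts F"
        using idx_G[OF b] eF[OF t(1)] by (auto simp: covered_verts_def)
    next
      fix x assume x: "x \<in> pverts (H i) \<inter> covered_verts F"
      then obtain p where p: "p \<in> F" "x \<in> set p" by (auto simp: covered_verts_def)
      then obtain t where t: "t < k" "p = e t" using e by (auto simp: bij_betw_def)
      then obtain b where b: "b \<in> set (bs t)" "x \<in> set b"
        using p(2) bs(1)[OF t(1), symmetric] by auto
      have "idx (hd b) = i" using bs(4)[OF t(1) b] idx_eq[OF i] x by auto
      then show "x \<in> covered_verts G" using b t by (auto simp: covered_verts_def G_def BS_def)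
    qed
    ultimately show "\<exists>G. k_path_subdigraph (H i) (card {u \<in> S. vert_class u = Some i}) G \<and>
       covered_verts G = pverts (H i) \<inter> covered_verts F"
      unfolding card_G by blast
  qed
qed

section \<open>Expanding an optimal cover to a path subdigraph\<close>

text \<open>The class bound for \<open>q\<close> limits the number of blocks of every competitor in
  each \<open>H i\<close>, and a best system with the permitted number of paths is substituted
  there.\<close>

lemma dominating_k_path_subdigraph:
  assumes k: "k \<ge> 1" and F0: "k_path_subdigraph Q k F0"
  shows "\<exists>F'. k_path_subdigraph Q k F' \<and> (\<forall>F. k_path_subdigraph Q k F \<longrightarrow>
    (\<forall>i\<in>pverts T. card (pverts (H i) \<inter> covered_verts F) \<le> card (pverts (H i) \<inter> covered_verts F')))"
proof -
  interpret E: extended_semicomplete "ext_verts k" vert_class class_arc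
    by (rule extended_semicomplete_ext)
  obtain p where p: "E.maximal_cover p" using E.maximal_cover_exists by blast
  have p_cov: "E.cycle_cover p" using p by (simp add: E.maximal_cover_def)
  have t0: "Inr 0 \<in> ext_verts k" "vert_class (Inr 0) = None" using k by (auto simp: ext_verts_def)
  have univ: "class_arc None (vert_class u) \<and> class_arc (vert_class u) None" if "vert_class u \<noteq> None" for u
    using that by auto
  obtain q where q: "E.cycle_cover q" "moved p \<subseteq> moved q" "\<forall>u\<in>moved q. E.hits None q u"
    using E.merged_cover_exists[OF p_cov t0 univ] by blast
  \<comment> \<open>A cover moving all points that a maximal one moves is maximal too, so the class
    bound applies to \<open>q\<close>.\<close>
  have q_max: "E.maximal_cover q"
    using p q(1,2) unfolding E.maximal_cover_def by blast
  define M where "M = {u \<in> moved q. vert_class u \<noteq> None}"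
  define U where "U i = {u \<in> moved q. vert_class u = Some i}" for i
  have finM: "finite (moved q)" using E.moved_subset[OF q(1)] E.finite_V finite_subset by blast
  have MD: "\<exists>x. u = Inl x \<and> x \<in> pverts Q \<and> idx x \<in> pverts T \<and> u \<in> U (idx x)" if u: "u \<in> M" for u
  proof -
    have "u \<in> ext_verts k" "vert_class u \<noteq> None" using u E.moved_subset[OF q(1)] by (auto simp: M_def)
    then obtain x where "u = Inl x" "x \<in> pverts Q" by (auto simp: ext_verts_def)
    then show ?thesis using idx_in u by (auto simp: M_def U_def)
  qed
  have UM: "U i \<subseteq> M" for i by (auto simp: U_def M_def)
  have bound: "card {u \<in> S. vert_class u = i} \<le> card {u \<in> moved q. vert_class u = i}"
    if "S \<subseteq> ext_verts k" "inj_on f S" "f ` S \<subseteq> S"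
      "\<And>u. u \<in> S \<Longrightarrow> class_arc (vert_class u) (vert_class (f u))" for S f i
    using E.maximal_cover_class[OF q_max that(1-3)] that(4) by (simp add: E.arc_def)
  \<comment> \<open>The contraction of \<open>F0\<close> passes through all \<open>k\<close>
    additional vertices, so the bound for class \<open>None\<close> forces \<open>q\<close> to move
    them all. This is what makes the number of paths exactly \<open>k\<close>.\<close>
  have star_moved: "q t \<noteq> t" if t: "t \<in> ext_verts k" "vert_class t = None" for t
  proof -
    obtain S f where S: "S \<subseteq> ext_verts k" "inj_on f S" "f ` S \<subseteq> S"
      "\<And>u. u \<in> S \<Longrightarrow> class_arc (vert_class u) (vert_class (f u))" "Inr ` {..<k} \<subseteq> S"
      by (rule contract_to_cycles[OF F0]) blast+
    have stars: "{u \<in> ext_verts k. vert_class u = None} = Inr ` {..<k}" by (auto simp: ext_verts_def)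
    have sub: "{u \<in> moved q. vert_class u = None} \<subseteq> Inr ` {..<k}"
      using E.moved_subset[OF q(1)] unfolding stars[symmetric] by blast
    have "{u \<in> S. vert_class u = None} = Inr ` {..<k}"
      using S(1,5) unfolding stars[symmetric] by blast
    then have "card (Inr ` {..<k} :: ('a + nat) set) \<le> card {u \<in> moved q. vert_class u = None}"
      using bound[OF S(1-4), of None] by simp
    then have "{u \<in> moved q. vert_class u = None} = Inr ` {..<k}"
      using sub by (intro card_seteq) auto
    then show ?thesis using t stars by blast
  qed
  obtain P where P1: "\<And>t. t \<in> ext_verts k \<Longrightarrow> vert_class t = None \<Longrightarrow>
      P t \<noteq> [] \<and> distinct (P t) \<and> successively E.arc (P t)"
    and P2: "\<And>t t'. t \<in> ext_verts k \<Longrightarrow> vert_class t = None \<Longrightarrow> t' \<in> ext_verts k \<Longrightarrow>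
      vert_class t' = None \<Longrightarrow> t \<noteq> t' \<Longrightarrow> set (P t) \<inter> set (P t') = {}"
    and P3: "(\<Union>t\<in>{t \<in> ext_verts k. vert_class t = None}. set (P t)) = {u \<in> moved q. vert_class u \<noteq> None}"
    by (rule E.cover_path_decomposition[OF q(1) q(3) star_moved]) blast+
  have star: "Inr t \<in> ext_verts k" "vert_class (Inr t) = None" if "t < k" for t
    using that by (auto simp: ext_verts_def)
  have PM: "u \<in> M" if "t < k" "u \<in> set (P (Inr t))" for t u
    using P3 star[OF that(1)] that(2) unfolding M_def by blast
  have MP: "\<exists>t<k. u \<in> set (P (Inr t))" if "u \<in> M" for u
  proof -
    have "u \<in> (\<Union>t\<in>{t \<in> ext_verts k. vert_class t = None}. set (P t))"
      using that unfolding P3 M_def .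
    then show ?thesis by (auto simp: ext_verts_def)
  qed
  \<comment> \<open>Taking as many paths as there are moved vertices of class \<open>i\<close>
    allows each vertex to be replaced by a path of its own.\<close>
  have "\<exists>G b. k_path_subdigraph (H i) (card (U i)) G \<and>
      (\<forall>m F. k_path_subdigraph (H i) m F \<longrightarrow> m \<le> card (U i) \<longrightarrow> card (covered_verts F) \<le> card (covered_verts G)) \<and>
      bij_betw b (U i) G" if i: "i \<in> pverts T" for i
  proof -
    have "U i \<subseteq> Inl ` pverts (H i)"
    proof
      fix u assume u: "u \<in> U i"
      then obtain x where "u = Inl x" "x \<in> pverts Q" using MD UM by blast
      then show "u \<in> Inl ` pverts (H i)" using u idx_in(2) by (auto simp: U_def)
    qed
    then have "card (U i) \<le> card (pverts (H i))"
      using finite_pverts(2)[OF i] by (metis card_image_le card_mono finite_imageI le_trans)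
    then obtain G where G: "k_path_subdigraph (H i) (card (U i)) G"
      "\<And>m F. k_path_subdigraph (H i) m F \<Longrightarrow> m \<le> card (U i) \<Longrightarrow> card (covered_verts F) \<le> card (covered_verts G)"
      by (rule best_k_path_subdigraph_exists[OF finite_pverts(2)[OF i]]) blast
    have "finite (U i)" using finM by (auto simp: U_def)
    moreover have "finite G" "card (U i) = card G" using G(1) by (auto simp: k_path_subdigraph_def)
    ultimately obtain b where "bij_betw b (U i) G" using finite_same_card_bij by blast
    then show ?thesis using G by blast
  qed
  then obtain G b where
    G: "\<And>i. i \<in> pverts T \<Longrightarrow> k_path_subdigraph (H i) (card (U i)) (G i)"
    and best: "\<And>i m F. i \<in> pverts T \<Longrightarrow> k_path_subdigraph (H i) m F \<Longrightarrow> m \<le> card (U i) \<Longrightarrow>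
      card (covered_verts F) \<le> card (covered_verts (G i))"
    and b: "\<And>i. i \<in> pverts T \<Longrightarrow> bij_betw (b i) (U i) (G i)"
    by metis
  define g where "g u = b (the (vert_class u)) u" for u
  have g_U: "g u = b i u" if "u \<in> U i" for u i using that by (simp add: g_def U_def)
  have g_in: "g u \<in> G i" if "i \<in> pverts T" "u \<in> U i" for u i
    using b[OF that(1)] that(2) g_U[OF that(2)] by (auto simp: bij_betw_def)
  have g_path: "g u \<noteq> []" "distinct (g u)" "set (g u) \<subseteq> pverts (H i)"
    "successively (\<lambda>x y. (x, y) \<in> parcs (H i)) (g u)" if "i \<in> pverts T" "u \<in> U i" for u i
    using G[OF that(1)] g_in[OF that] by (auto simp: k_path_subdigraph_def vpath_with_proj_iff)
  have g_disj: "set (g u) \<inter> set (g w) = {}" if "u \<in> M" "w \<in> M" "u \<noteq> w" for u w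
  proof -
    obtain i j where i: "i \<in> pverts T" "u \<in> U i" and j: "j \<in> pverts T" "w \<in> U j"
      using MD \<open>u \<in> M\<close> \<open>w \<in> M\<close> by blast
    show ?thesis
    proof (cases "i = j")
      case True
      then have "g u \<noteq> g w"
        using b[OF i(1)] i(2) j(2) g_U[OF i(2)] g_U[OF j(2)] \<open>u \<noteq> w\<close>
        by (auto simp: bij_betw_def inj_on_def)
      then show ?thesis using G[OF i(1)] g_in[OF i] g_in[OF j] True
        by (auto simp: k_path_subdigraph_def pairwise_def disjnt_def)
    next
      case False
      then show ?thesis using g_path(3)[OF i] g_path(3)[OF j] disjoint[OF i(1) j(1)] by blast
    qed
  qed
  have g_ne: "g u \<noteq> []" if "u \<in> M" for u using MD[OF that] g_path(1) by blast
  have g_inj: "inj_on g M"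
    using g_disj g_ne by (metis inj_onI inf.idem set_empty)
  define W where "W t = concat (map g (P (Inr t)))" for t
  have set_W: "set (W t) = (\<Union>u\<in>set (P (Inr t)). set (g u))" for t by (simp add: W_def)
  have W_path: "vpath (W t) (with_proj Q)" if t: "t < k" for t
    unfolding vpath_with_proj_iff
  proof (intro conjI)
    have Pt: "P (Inr t) \<noteq> []" "distinct (P (Inr t))" "successively E.arc (P (Inr t))"
      using P1[OF star[OF t]] by auto
    show "W t \<noteq> []" using Pt(1) g_ne PM[OF t] by (cases "P (Inr t)") (auto simp: W_def)
    have gx: "g u \<noteq> [] \<and> distinct (g u) \<and> set (g u) \<subseteq> pverts Q \<and>
        successively (\<lambda>x y. (x, y) \<in> parcs Q) (g u)" if u: "u \<in> M" for u
    proof -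
      obtain i where i: "i \<in> pverts T" "u \<in> U i" using MD[OF u] by blast
      have "successively (\<lambda>x y. (x, y) \<in> parcs Q) (g u)"
        using g_path(4)[OF i] by (rule successively_mono) (use i(1) in \<open>auto simp: composition_def\<close>)
      then show ?thesis using g_path(1-3)[OF i] i(1) by (auto simp: pverts_Q)
    qed
    show "distinct (W t)"
      unfolding W_def
    proof (rule distinct_concat)
      show "distinct (map g (P (Inr t)))"
        using Pt(2) g_inj PM[OF t] by (auto simp: distinct_map intro: inj_on_subset)
    next
      fix xs ys assume "xs \<in> set (map g (P (Inr t)))" "ys \<in> set (map g (P (Inr t)))" "xs \<noteq> ys"
      then obtain u w where "u \<in> M" "w \<in> M" "u \<noteq> w" "xs = g u" "ys = g w"
        using PM[OF t] by auto
      then show "set xs \<inter> set ys = {}" using g_disj by simp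
    qed (use gx PM[OF t] in auto)
    show "set (W t) \<subseteq> pverts Q" using gx PM[OF t] unfolding set_W by blast
    show "successively (\<lambda>x y. (x, y) \<in> parcs Q) (W t)"
      unfolding W_def
    proof (rule successively_concat_map[OF Pt(3)])
      fix u w assume u: "u \<in> set (P (Inr t))" and w: "w \<in> set (P (Inr t))" and arc: "E.arc u w"
      obtain i j where i: "i \<in> pverts T" "u \<in> U i" and j: "j \<in> pverts T" "w \<in> U j"
        using MD PM[OF t u] PM[OF t w] by blast
      \<comment> \<open>An arc of \<open>T\<close> joins all of \<open>H i\<close> to all of
        \<open>H j\<close>, so any ends of the substituted paths fit together.\<close>
      then have "(i, j) \<in> parcs T" using arc by (auto simp: E.arc_def U_def)
      moreover have "last (g u) \<in> pverts (H i)" "hd (g w) \<in> pverts (H j)"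
        using g_path(1,3)[OF i] g_path(1,3)[OF j] by auto
      ultimately show "(last (g u), hd (g w)) \<in> parcs Q" by (auto simp: composition_def)
    qed (use gx PM[OF t] in blast)
  qed
  have W_disj: "set (W t) \<inter> set (W t') = {}" if t: "t < k" "t' < k" "t \<noteq> t'" for t t'
  proof -
    have "set (P (Inr t)) \<inter> set (P (Inr t')) = {}"
      using P2 star t by simp
    then show ?thesis using g_disj PM t(1,2) unfolding set_W by blast
  qed
  have W_inj: "inj_on W {..<k}"
  proof (rule inj_onI)
    fix t t' assume t: "t \<in> {..<k}" "t' \<in> {..<k}" "W t = W t'"
    then have "W t \<noteq> []" using W_path[of t] by (auto simp: vpath_with_proj_iff)
    then show "t = t'" using W_disj[of t t'] t by auto
  qed
  have W_k: "k_path_subdigraph Q k (W ` {..<k})"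
    using W_path W_inj W_disj
    by (auto simp: k_path_subdigraph_def card_image pairwise_def disjnt_def)
  have W_cov: "pverts (H i) \<inter> covered_verts (W ` {..<k}) = covered_verts (G i)" if i: "i \<in> pverts T" for i
  proof (intro equalityI subsetI)
    fix x assume x: "x \<in> pverts (H i) \<inter> covered_verts (W ` {..<k})"
    then obtain t u where t: "t < k" "u \<in> set (P (Inr t))" "x \<in> set (g u)"
      by (auto simp: covered_verts_def set_W)
    obtain j where j: "j \<in> pverts T" "u \<in> U j" using MD[OF PM[OF t(1,2)]] by blast
    then have "x \<in> pverts (H j)" using g_path(3) t(3) by blast
    then have "j = i" using x disjoint i j(1) by blast
    then show "x \<in> covered_verts (G i)" using g_in[OF j] t(3) by (auto simp: covered_verts_def)
  next
    fix x assume "x \<in> covered_verts (G i)"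
    then obtain p where p: "p \<in> G i" "x \<in> set p" by (auto simp: covered_verts_def)
    have "p \<in> b i ` U i" using p(1) bij_betw_imp_surj_on[OF b[OF i]] by simp
    then obtain u where u: "u \<in> U i" "p = g u" using g_U by auto
    then obtain t where "t < k" "u \<in> set (P (Inr t))" using MP UM by blast
    then show "x \<in> pverts (H i) \<inter> covered_verts (W ` {..<k})"
      using g_path(3)[OF i u(1)] u(2) p(2) by (auto simp: covered_verts_def set_W)
  qed
  have "card (pverts (H i) \<inter> covered_verts F) \<le> card (pverts (H i) \<inter> covered_verts (W ` {..<k}))"
    if F: "k_path_subdigraph Q k F" and i: "i \<in> pverts T" for F i
  proof -
    obtain S f where S: "S \<subseteq> ext_verts k" "inj_on f S" "f ` S \<subseteq> S"
      "\<And>u. u \<in> S \<Longrightarrow> class_arc (vert_class u) (vert_class (f u))"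
      and ex: "\<And>i. i \<in> pverts T \<Longrightarrow>
        \<exists>G. k_path_subdigraph (H i) (card {u \<in> S. vert_class u = Some i}) G \<and>
          covered_verts G = pverts (H i) \<inter> covered_verts F"
      by (rule contract_to_cycles[OF F]) blast+
    obtain G' where G': "k_path_subdigraph (H i) (card {u \<in> S. vert_class u = Some i}) G'"
      "covered_verts G' = pverts (H i) \<inter> covered_verts F"
      using ex[OF i] by blast
    \<comment> \<open>The blocks of the competitor in \<open>H i\<close> form a system of at most
      \<open>card (U i)\<close> paths, and \<open>G i\<close> is best among those.\<close>
    have "card {u \<in> S. vert_class u = Some i} \<le> card (U i)"
      using bound[OF S, of "Some i"] by (simp add: U_def)
    then show ?thesis using best[OF i G'(1)] G'(2) W_cov[OF i] by simp
  qed
  then show ?thesis using W_k by blast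
qed

section \<open>Comparing totals over the classes\<close>

lemma card_covered_verts_sum:
  assumes "k_path_subdigraph Q k F"
  shows "card (covered_verts F) = (\<Sum>i\<in>pverts T. card (pverts (H i) \<inter> covered_verts F))"
proof -
  have "covered_verts F = (\<Union>i\<in>pverts T. pverts (H i) \<inter> covered_verts F)"
    using covered_verts_subset[OF assms] by (auto simp: pverts_Q)
  moreover have "card (\<Union>i\<in>pverts T. pverts (H i) \<inter> covered_verts F) =
      (\<Sum>i\<in>pverts T. card (pverts (H i) \<inter> covered_verts F))"
    by (rule card_UN_disjoint) (use finite_pverts disjoint in auto)
  ultimately show ?thesis by metis
qed

end

theorem theorem3p6:
  fixes T :: "'i pair_pre_digraph"
    and H :: "'i \<Rightarrow> 'a pair_pre_digraph"
    and Q :: "'a pair_pre_digraph"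
    and n :: nat
  assumes "pair_digraph T"
    and "card (pverts T) \<ge> 2"
    and "\<And>i. i \<in> pverts T \<Longrightarrow> pair_digraph (H i)"
    and "\<And>i. i \<in> pverts T \<Longrightarrow> pverts (H i) \<noteq> {}"
    and "\<And>i j. i \<in> pverts T \<Longrightarrow> j \<in> pverts T \<Longrightarrow> i \<noteq> j \<Longrightarrow> pverts (H i) \<inter> pverts (H j) = {}"
    and "semicomplete T"
    and "Q = composition T H"
    and "strongly_connected (with_proj Q)"
    and "n = card (pverts Q)"
  shows "\<forall>k\<in>{1..n}. \<forall>i\<in>pverts T. \<exists>m::nat.
           (\<forall>F. maximum_k_path_subdigraph Q k F \<longrightarrow>
                  card (pverts (H i) \<inter> covered_verts F) = m) \<and>
           (\<forall>F. k_path_subdigraph Q k F \<longrightarrow>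
                  card (pverts (H i) \<inter> covered_verts F) \<le> m)"
proof (intro ballI)
  interpret C: semicomplete_composition T H
    by (rule semicomplete_composition.intro) (fact assms)+
  fix k i assume k: "k \<in> {1..n}" and i: "i \<in> pverts T"
  show "\<exists>m::nat.
           (\<forall>F. maximum_k_path_subdigraph Q k F \<longrightarrow>
                  card (pverts (H i) \<inter> covered_verts F) = m) \<and>
           (\<forall>F. k_path_subdigraph Q k F \<longrightarrow>
                  card (pverts (H i) \<inter> covered_verts F) \<le> m)"
  proof (cases "\<exists>F. k_path_subdigraph Q k F")
    case False
    \<comment> \<open>Both claims are vacuous here, and any number serves.\<close>
    then show ?thesis by (auto simp: maximum_k_path_subdigraph_def)
  next
    case True
    then obtain F0 where F0: "k_path_subdigraph C.Q k F0" unfolding assms(7) by blast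
    have "1 \<le> k" using k by simp
    then obtain M where M: "k_path_subdigraph Q k M"
      and best: "\<And>F j. k_path_subdigraph Q k F \<Longrightarrow> j \<in> pverts T \<Longrightarrow>
        card (pverts (H j) \<inter> covered_verts F) \<le> card (pverts (H j) \<inter> covered_verts M)"
      using C.dominating_k_path_subdigraph[OF _ F0] unfolding assms(7) by blast
    have "card (pverts (H i) \<inter> covered_verts F) = card (pverts (H i) \<inter> covered_verts M)"
      if "maximum_k_path_subdigraph Q k F" for F
    proof (rule ccontr)
      assume neq: "\<not> ?thesis"
      have F: "k_path_subdigraph Q k F" and le: "card (covered_verts M) \<le> card (covered_verts F)"
        using that M by (auto simp: maximum_k_path_subdigraph_def)
      \<comment> \<open>\<open>M\<close> is at least as good in every \<open>H j\<close> and would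
        be strictly better in \<open>H i\<close>, so it would cover more vertices than the maximum
        \<open>F\<close>.\<close>
      have "(\<Sum>j\<in>pverts T. card (pverts (H j) \<inter> covered_verts F)) <
          (\<Sum>j\<in>pverts T. card (pverts (H j) \<inter> covered_verts M))"
        using C.finite_pverts(1) best[OF F] neq i
        by (intro sum_strict_mono_ex1) (auto simp: le_less)
      then show False
        using le C.card_covered_verts_sum F M unfolding assms(7) by simp
    qed
    then show ?thesis using best i by blast
  qed
qed

end
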